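(* Let $F(w)=\mathbb{E}[f(w;\xi)]$, $w\in\mathbb{R}^d$, where for every realization of $\xi$ the function $f(\cdot;\xi)$ is convex and $L$-smooth with a common constant $L>0$. Let $w_*=\arg\min_wF(w)$ and $N=2\,\mathbb{E}[\|\nabla f(w_*;\xi)\|^2]$. Then for all $w\in\mathbb{R}^d$, $$\mathbb{E}[\|\nabla f(w;\xi)\|^2]\le 4L\,[F(w)-F(w_* )]+N .$$
   Context: $\xi$ is a random variable, $f(\cdot;\xi):\mathbb{R}^d\to\mathbb{R}$ is differentiable for each realization of $\xi$, and $\mathbb{E}[\nabla f(w;\xi)]=\nabla F(w)$ for every fixed $w$. $\|\cdot\|$ is the Euclidean norm. A minimizer $w_*$ of $F$ exists (the paper assumes throughout that $F$ is strongly convex, so it is unique). $L$-smooth: $\|\nabla f(w;\xi)-\nabla f(w';\xi)\|\le L\|w-w'\|$ for all $w,w'\in\mathbb{R}^d$. Convex: $f(w;\xi)-f(w';\xi)\ge\langle\nabla f(w';\xi),w-w'\rangle$ for all $w,w'\in\mathbb{R}^d$. *)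

theory Defs
  imports "HOL-Probability.Probability"
begin

definition gradient :: "('a::euclidean_space \<Rightarrow> real) \<Rightarrow> 'a \<Rightarrow> 'a"  ("\<nabla>") where
  "\<nabla> g x = (THE D. GDERIV g x :> D)"

lemma gderiv_unique:
  fixes g :: "'a::euclidean_space \<Rightarrow> real"
  assumes "GDERIV g x :> D" and "GDERIV g x :> E"
  shows "D = E"
proof -
  have "(\<lambda>h. h \<bullet> D) = (\<lambda>h. h \<bullet> E)"
    using assms unfolding gderiv_def by (rule has_derivative_unique)
  then have "h \<bullet> D = h \<bullet> E" for h
    by (rule fun_cong)
  then show ?thesis
    using vector_eq_ldot[of D E] by blast
qed

lemma gderiv_gradient:
  fixes g :: "'a::euclidean_space \<Rightarrow> real"
  assumes "g differentiable (at x)"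
  shows "GDERIV g x :> \<nabla> g x"
proof -
  from assms obtain g' where g': "(g has_derivative g') (at x)"
    unfolding differentiable_def by blast
  then have lin: "linear g'"
    by (rule has_derivative_linear)
  have "g' = (\<lambda>h. h \<bullet> adjoint g' 1)"
    using adjoint_works[OF lin, of _ 1] by (auto simp: fun_eq_iff)
  with g' have "GDERIV g x :> adjoint g' 1"
    unfolding gderiv_def by simp
  then show ?thesis
    unfolding gradient_def by (rule theI) (rule gderiv_unique[OF _ \<open>GDERIV g x :> adjoint g' 1\<close>])
qed

text \<open>
  Convexity is stated through its first-order form.
  Neither predicate below includes differentiability, which has to be assumed separately.
\<close>

definition smooth_with :: "real \<Rightarrow> ('a::euclidean_space \<Rightarrow> real) \<Rightarrow> bool" where
  "smooth_with L g \<longleftrightarrow> (\<forall>w w'. norm (\<nabla> g w - \<nabla> g w') \<le> L * norm (w - w'))"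

definition convex_grad :: "('a::euclidean_space \<Rightarrow> real) \<Rightarrow> bool" where
  "convex_grad g \<longleftrightarrow> (\<forall>w w'. g w - g w' \<ge> \<nabla> g w' \<bullet> (w - w'))"

end

theory Submission
  imports Defs
begin

text \<open>
  Write \<open>D\<close> for \<open>f(w) - f(w\<^sub>*) - \<langle>\<nabla>f(w\<^sub>*), w - w\<^sub>*\<rangle>\<close> at a fixed realization. Minimizing the
  quadratic upper model of \<open>f\<close> at \<open>w\<close> against its linear lower model at \<open>w\<^sub>*\<close> gives
  \<open>\<parallel>\<nabla>f(w) - \<nabla>f(w\<^sub>*)\<parallel>\<^sup>2 \<le> 2 L D\<close>, hence \<open>\<parallel>\<nabla>f(w)\<parallel>\<^sup>2 \<le> 4 L D + 2 \<parallel>\<nabla>f(w\<^sub>*)\<parallel>\<^sup>2\<close>. In expectation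
  the linear term of \<open>D\<close> vanishes because \<open>\<nabla>F(w\<^sub>*) = 0\<close>.
\<close>

lemma gradient_eq_0_at_arg_min:
  fixes F :: "'a::euclidean_space \<Rightarrow> real"
  assumes "F differentiable (at x)" and "is_arg_min F (\<lambda>_. True) x"
  shows "\<nabla> F x = 0"
proof -
  have "((\<lambda>h. h \<bullet> \<nabla> F x) = (\<lambda>h. 0))"
  proof (rule has_derivative_local_min)
    show "(F has_derivative (\<lambda>h. h \<bullet> \<nabla> F x)) (at x)"
      using gderiv_gradient[OF assms(1)] unfolding gderiv_def .
    show "\<forall>\<^sub>F y in at x. F x \<le> F y"
      using assms(2) by (simp add: is_arg_min_linorder)
  qed
  \<comment> \<open>The zero functional is evaluated in the direction
    \<open>h = \<nabla> F x\<close>.\<close>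
  then have "\<nabla> F x \<bullet> \<nabla> F x = 0"
    by (rule fun_cong)
  then show ?thesis by simp
qed

text \<open>Along the segment from \<open>x\<close> to \<open>x + d\<close> the slope of
  \<open>g\<close> exceeds its initial value by at most \<open>L * t * (norm d)\<^sup>2\<close>, by
  Cauchy-Schwarz and the Lipschitz bound; integrating over \<open>t\<close> in [0, 1] produces the
  factor 1/2. Monotonicity of an auxiliary function replaces the integral.\<close>

lemma smooth_with_quadratic_upper_bound:
  fixes g :: "'a::euclidean_space \<Rightarrow> real"
  assumes diff: "\<And>x. g differentiable (at x)" and sm: "smooth_with L g"
  shows "g (x + d) \<le> g x + \<nabla> g x \<bullet> d + L / 2 * (norm d)\<^sup>2"
proof -
  \<comment> \<open>Since \<open>\<phi> 0 = g x\<close>, the claim is exactly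
    \<open>\<phi> 1 \<le> \<phi> 0\<close>.\<close>
  define \<phi> where "\<phi> t = g (x + t *\<^sub>R d) - t * (\<nabla> g x \<bullet> d) - L / 2 * t\<^sup>2 * (norm d)\<^sup>2" for t
  have der: "(\<phi> has_real_derivative
      (\<nabla> g (x + t *\<^sub>R d) - \<nabla> g x) \<bullet> d - L * t * (norm d)\<^sup>2) (at t)" for t
  proof -
    have "(g has_derivative (\<lambda>h. h \<bullet> \<nabla> g (x + t *\<^sub>R d))) (at (x + t *\<^sub>R d))"
      using gderiv_gradient[OF diff] unfolding gderiv_def .
    moreover have "((\<lambda>t. x + t *\<^sub>R d) has_derivative (\<lambda>s. s *\<^sub>R d)) (at t)"
      by (auto intro!: derivative_eq_intros)
    ultimately have "((\<lambda>t. g (x + t *\<^sub>R d)) has_derivative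
        (\<lambda>s. (s *\<^sub>R d) \<bullet> \<nabla> g (x + t *\<^sub>R d))) (at t)"
      by (rule has_derivative_compose[rotated])
    then have "((\<lambda>t. g (x + t *\<^sub>R d)) has_real_derivative \<nabla> g (x + t *\<^sub>R d) \<bullet> d) (at t)"
      by (simp add: has_field_derivative_def inner_commute mult_commute_abs)
    then show ?thesis
      unfolding \<phi>_def by (auto intro!: derivative_eq_intros simp: inner_diff_left)
  qed
  have "\<phi> 1 \<le> \<phi> 0"
  proof (rule DERIV_nonpos_imp_nonincreasing[of 0 1])
    fix t :: real assume t: "0 \<le> t"
    have "(\<nabla> g (x + t *\<^sub>R d) - \<nabla> g x) \<bullet> d \<le> norm (\<nabla> g (x + t *\<^sub>R d) - \<nabla> g x) * norm d"
      by (rule norm_cauchy_schwarz)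
    also have "\<dots> \<le> (L * norm (x + t *\<^sub>R d - x)) * norm d"
      using sm unfolding smooth_with_def by (intro mult_right_mono norm_ge_zero) blast
    also have "\<dots> = L * t * (norm d)\<^sup>2"
      using t by (simp add: power2_eq_square)
    finally show "\<exists>y. (\<phi> has_real_derivative y) (at t) \<and> y \<le> 0"
      using der[of t] by auto
  qed simp
  then show ?thesis
    by (simp add: \<phi>_def)
qed

lemma convex_smooth_gradient_diff_bound:
  fixes g :: "'a::euclidean_space \<Rightarrow> real"
  assumes diff: "\<And>x. g differentiable (at x)" and "L > 0"
    and conv: "convex_grad g" and sm: "smooth_with L g"
  shows "(norm (\<nabla> g w - \<nabla> g u))\<^sup>2 \<le> 2 * L * (g w - g u - \<nabla> g u \<bullet> (w - u))"
proof -
  define v where "v = \<nabla> g w - \<nabla> g u"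
  \<comment> \<open>\<open>w + d\<close> minimizes the gap between the quadratic model at \<open>w\<close> and the linear model at \<open>u\<close>.\<close>
  define d where "d = - (1 / L) *\<^sub>R v"
  have "g u + \<nabla> g u \<bullet> (w + d - u) \<le> g (w + d)"
    using conv unfolding convex_grad_def by (simp add: le_diff_eq add.commute)
  also have "\<dots> \<le> g w + \<nabla> g w \<bullet> d + L / 2 * (norm d)\<^sup>2"
    by (rule smooth_with_quadratic_upper_bound[OF diff sm])
  finally have "- (v \<bullet> d) - L / 2 * (norm d)\<^sup>2 \<le> g w - g u - \<nabla> g u \<bullet> (w - u)"
    by (simp add: v_def algebra_simps)
  \<comment> \<open>For this \<open>d\<close> the linear gain is \<open>(norm v)\<^sup>2 / L\<close>
    and the quadratic cost is half of it, so the other half remains as the lower bound.\<close>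
  moreover have "v \<bullet> d = - ((norm v)\<^sup>2 / L)"
    by (simp add: d_def power2_norm_eq_inner)
  moreover have "L / 2 * (norm d)\<^sup>2 = (norm v)\<^sup>2 / (2 * L)"
    using \<open>L > 0\<close> by (simp add: d_def power_mult_distrib power_divide field_simps power2_eq_square)
  ultimately have "(norm v)\<^sup>2 / (2 * L) \<le> g w - g u - \<nabla> g u \<bullet> (w - u)"
    by (simp add: field_simps)
  then show ?thesis
    using \<open>L > 0\<close> by (simp add: v_def field_simps)
qed

lemma norm_sq_le_twice_diff:
  fixes a b :: "'a::real_inner"
  shows "(norm a)\<^sup>2 \<le> 2 * (norm (a - b))\<^sup>2 + 2 * (norm b)\<^sup>2"
proof -
  \<comment> \<open>This square is exactly the right side of the claim minus the left side.\<close>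
  have "0 \<le> (norm (a - 2 *\<^sub>R b))\<^sup>2" by simp
  then show ?thesis
    by (simp add: power2_norm_eq_inner algebra_simps inner_commute)
qed

text \<open>Second moments are integrals with values in [0, \<infinity>], so the bound is meaningful
  also for infinite \<open>N\<close>. Since \<open>w_star\<close> minimizes \<open>F\<close>, the
  difference \<open>F w - F w_star\<close> is nonnegative and \<open>ennreal\<close> does not
  truncate it.\<close>

theorem lemma1:
  fixes M :: "'a measure" and S :: "'s measure" and \<xi> :: "'a \<Rightarrow> 's"
    and f :: "real ^ 'd \<Rightarrow> 's \<Rightarrow> real" and F :: "real ^ 'd \<Rightarrow> real"
    and L :: real and w_star :: "real ^ 'd" and N :: ennreal
  assumes "prob_space M"
    and "\<xi> \<in> measurable M S"
    and "\<And>w. integrable M (\<lambda>\<omega>. f w (\<xi> \<omega>))"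
    and "F = (\<lambda>w. \<integral>\<omega>. f w (\<xi> \<omega>) \<partial>M)"
    and "\<And>\<omega> w. \<omega> \<in> space M \<Longrightarrow> (\<lambda>v. f v (\<xi> \<omega>)) differentiable (at w)"
    and "\<And>w. F differentiable (at w)"
    and "\<And>w. has_bochner_integral M (\<lambda>\<omega>. \<nabla> (\<lambda>v. f v (\<xi> \<omega>)) w) (\<nabla> F w)"
    and "L > 0"
    and "\<And>\<omega>. \<omega> \<in> space M \<Longrightarrow> convex_grad (\<lambda>v. f v (\<xi> \<omega>))"
    and "\<And>\<omega>. \<omega> \<in> space M \<Longrightarrow> smooth_with L (\<lambda>v. f v (\<xi> \<omega>))"
    and "is_arg_min F (\<lambda>_. True) w_star"
    and "N = 2 * (\<integral>\<^sup>+\<omega>. ennreal ((norm (\<nabla> (\<lambda>v. f v (\<xi> \<omega>)) w_star))\<^sup>2) \<partial>M)"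
  shows "\<forall>w. (\<integral>\<^sup>+\<omega>. ennreal ((norm (\<nabla> (\<lambda>v. f v (\<xi> \<omega>)) w))\<^sup>2) \<partial>M)
               \<le> ennreal (4 * L * (F w - F w_star)) + N"
proof
  fix w
  define G where "G \<omega> = \<nabla> (\<lambda>v. f v (\<xi> \<omega>))" for \<omega>
  define D where "D \<omega> = f w (\<xi> \<omega>) - f w_star (\<xi> \<omega>) - G \<omega> w_star \<bullet> (w - w_star)" for \<omega>
  have G: "has_bochner_integral M (\<lambda>\<omega>. G \<omega> u) (\<nabla> F u)" for u
    unfolding G_def by (rule assms(7))
  have [measurable]: "(\<lambda>\<omega>. G \<omega> u) \<in> borel_measurable M" for u
    using G[of u] by (auto simp: has_bochner_integral_iff)
  have "\<nabla> F w_star = 0"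
    using assms(6,11) by (rule gradient_eq_0_at_arg_min)
  moreover have "has_bochner_integral M (\<lambda>\<omega>. f u (\<xi> \<omega>)) (F u)" for u
    using assms(3) by (simp add: assms(4) has_bochner_integral_iff)
  ultimately have D: "has_bochner_integral M D (F w - F w_star)"
    using has_bochner_integral_diff[OF has_bochner_integral_diff
        has_bochner_integral_inner_left[OF G[of w_star], of "w - w_star"], of _ "F w" _ "F w_star"]
    unfolding D_def by simp
  then have [measurable]: "D \<in> borel_measurable M"
    by (auto simp: has_bochner_integral_iff)
  have key: "(norm (G \<omega> w - G \<omega> w_star))\<^sup>2 \<le> 2 * L * D \<omega>" if "\<omega> \<in> space M" for \<omega>
    unfolding G_def D_def
    by (rule convex_smooth_gradient_diff_bound) (use assms that in auto)
  \<comment> \<open>This is convexity at \<open>w_star\<close>. The sign lets \<open>ennreal\<close>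
    split over the sum below, and later identifies the nonnegative integral of \<open>D\<close> with
    its Bochner integral.\<close>
  have nonneg: "0 \<le> D \<omega>" if "\<omega> \<in> space M" for \<omega>
    using assms(9)[OF that] unfolding D_def G_def convex_grad_def by simp
  have "(\<integral>\<^sup>+\<omega>. ennreal ((norm (G \<omega> w))\<^sup>2) \<partial>M)
      \<le> (\<integral>\<^sup>+\<omega>. ennreal (4 * L * D \<omega>) + 2 * ennreal ((norm (G \<omega> w_star))\<^sup>2) \<partial>M)"
  proof (rule nn_integral_mono)
    fix \<omega> assume \<omega>: "\<omega> \<in> space M"
    have "(norm (G \<omega> w))\<^sup>2 \<le> 4 * L * D \<omega> + 2 * (norm (G \<omega> w_star))\<^sup>2"
      using norm_sq_le_twice_diff[of "G \<omega> w" "G \<omega> w_star"] key[OF \<omega>] by simp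
    then have "ennreal ((norm (G \<omega> w))\<^sup>2) \<le> ennreal (4 * L * D \<omega> + 2 * (norm (G \<omega> w_star))\<^sup>2)"
      by (rule ennreal_leI)
    also have "\<dots> = ennreal (4 * L * D \<omega>) + 2 * ennreal ((norm (G \<omega> w_star))\<^sup>2)"
      using nonneg[OF \<omega>] \<open>L > 0\<close> by (simp add: ennreal_plus ennreal_mult)
    finally show "ennreal ((norm (G \<omega> w))\<^sup>2)
        \<le> ennreal (4 * L * D \<omega>) + 2 * ennreal ((norm (G \<omega> w_star))\<^sup>2)" .
  qed
  \<comment> \<open>Additivity rests on the measurability of \<open>D\<close> and of the gradients,
    which their Bochner integrability supplies.\<close>
  also have "\<dots> = (\<integral>\<^sup>+\<omega>. ennreal (4 * L * D \<omega>) \<partial>M)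
      + 2 * (\<integral>\<^sup>+\<omega>. ennreal ((norm (G \<omega> w_star))\<^sup>2) \<partial>M)"
    by (simp add: nn_integral_add nn_integral_cmult)
  also have "(\<integral>\<^sup>+\<omega>. ennreal (4 * L * D \<omega>) \<partial>M) = ennreal (4 * L * (F w - F w_star))"
    using D nonneg \<open>L > 0\<close>
    by (subst nn_integral_eq_integral) (auto simp: has_bochner_integral_iff)
  finally show "(\<integral>\<^sup>+\<omega>. ennreal ((norm (\<nabla> (\<lambda>v. f v (\<xi> \<omega>)) w))\<^sup>2) \<partial>M)
      \<le> ennreal (4 * L * (F w - F w_star)) + N"
    unfolding G_def assms(12) .
qed

end
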